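(* It is not true that the second dilatation $2\mathcal{P}$ of a very ample polytope $\mathcal{P}$ is always normal. Namely, the polytopes $\mathcal{P}_{k,a}$ are very ample, and, for a positive integer $n$, all dilatations up to $n$ of the polytope $\mathcal{P}_{n!,n!+2}$ are non-normal; that is, $s\mathcal{P}_{n!,n!+2}$ is not normal for every integer $s$ with $1\le s\le n$.
   Context: Let $k$ be a positive integer and $a\ge0$ an integer. Let $C_{2k}$ be the cycle with vertices $1,\dots,2k$ in cyclic order and edges $(i,i+1)$, $i=1,\dots,2k$, where $(2k,2k+1)$ means $(2k,1)$. For an edge $e$ let $V(e)\in\mathbb{Z}^{2k}$ be the vector with coordinates $V(e)_v=1$ if $v\in e$ and $V(e)_v=0$ otherwise. The polytope $\mathcal{P}_{k,a}$ is the convex hull in $\mathbb{Z}^{2k}\times\mathbb{Z}$ (tensored with the reals) of the points $(V(i,i+1),0)$, $(V(i,i+1),1)$ for $i=2,3,\dots,2k$, together with $(V(1,2),a)$ and $(V(1,2),a+1)$. A lattice polytope $\mathcal{P}$ is normal in a lattice $M$ (for $\mathcal{P}_{k,a}$, $M=\mathbb{Z}^{2k}\times\mathbb{Z}$) if for every positive integer $m$ every lattice point in $m\mathcal{P}$ is a sum of $m$ lattice points of $\mathcal{P}$; it is very ample in $M$ if this holds for every sufficiently large $m$.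
   Formalization: Non-normality of sP_{n!,n!+2} for 1≤s≤n is stated only when s<n!, which excludes exactly (n,s)=(1,1) and (2,2); there the claim is false, since P_{1,3} is a lattice segment and 2P_{2,4} is normal. *)

theory Defs
  imports "HOL-Analysis.Analysis" "HOL-Library.Function_Algebras"
begin

text \<open>Pointwise scalar multiplication makes functions into real vectors a real vector space, so that
  the library's convex hull is available for vectors whose number of coordinates is a term.\<close>

instantiation "fun" :: (type, real_vector) real_vector
begin

definition scaleR_fun :: "real \<Rightarrow> ('a \<Rightarrow> 'b) \<Rightarrow> 'a \<Rightarrow> 'b" where
  "scaleR_fun c f = (\<lambda>x. c *\<^sub>R f x)"

instance
  by standard (simp_all add: scaleR_fun_def plus_fun_def scaleR_add_right scaleR_add_left)

end

lemma scaleR_fun_apply [simp]: "(c *\<^sub>R f) x = c *\<^sub>R f x"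
  by (simp add: scaleR_fun_def)


definition dilate :: "nat \<Rightarrow> 'a::real_vector set \<Rightarrow> 'a set" where
  "dilate m P = (\<lambda>x. real m *\<^sub>R x) ` P"

definition lattice_polytope :: "'a::real_vector set \<Rightarrow> 'a set \<Rightarrow> bool" where
  "lattice_polytope M P \<longleftrightarrow> (\<exists>S. finite S \<and> S \<subseteq> M \<and> P = convex hull S)"

definition lattice_points_decompose :: "'a::real_vector set \<Rightarrow> 'a set \<Rightarrow> nat \<Rightarrow> bool" where
  "lattice_points_decompose M P m \<longleftrightarrow>
     (\<forall>x \<in> dilate m P \<inter> M. \<exists>p. (\<forall>i<m. p i \<in> P \<inter> M) \<and> x = (\<Sum>i<m. p i))"

definition normal_polytope :: "'a::real_vector set \<Rightarrow> 'a set \<Rightarrow> bool" where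
  "normal_polytope M P \<longleftrightarrow> (\<forall>m\<ge>1. lattice_points_decompose M P m)"

definition very_ample_polytope :: "'a::real_vector set \<Rightarrow> 'a set \<Rightarrow> bool" where
  "very_ample_polytope M P \<longleftrightarrow> (\<forall>\<^sub>F m in sequentially. lattice_points_decompose M P m)"


text \<open>The lattice of integer points in $2k+1$ coordinates. The first $2k$ coordinates are indexed by
  the vertices $1, \dots, 2k$ of the cycle; the function is zero outside this range.\<close>

definition cycle_lattice :: "nat \<Rightarrow> ((nat \<Rightarrow> real) \<times> real) set" where
  "cycle_lattice k =
     {(x, z). (\<forall>v. x v \<in> \<int>) \<and> (\<forall>v. v \<notin> {1..2*k} \<longrightarrow> x v = 0) \<and> z \<in> \<int>}"

definition cycle_edge :: "nat \<Rightarrow> nat \<Rightarrow> nat set" where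
  "cycle_edge k i = {i, if i = 2*k then 1 else i + 1}"

definition edge_vector :: "nat set \<Rightarrow> nat \<Rightarrow> real" where
  "edge_vector e = (\<lambda>v. if v \<in> e then 1 else 0)"

definition cycle_polytope :: "nat \<Rightarrow> nat \<Rightarrow> ((nat \<Rightarrow> real) \<times> real) set" where
  "cycle_polytope k a = convex hull
     ((\<Union>i\<in>{2..2*k}. {(edge_vector (cycle_edge k i), 0), (edge_vector (cycle_edge k i), 1)})
      \<union> {(edge_vector (cycle_edge k 1), real a), (edge_vector (cycle_edge k 1), real a + 1)})"

end

theory Submission
  imports Defs
begin

text \<open>
  A point of \<open>m\<P>\<close> is a nonnegative real weighting \<open>w\<close> of the edges of the cycle with total weight
  \<open>m\<close>, together with a height in the interval from \<open>a w\<^sub>1\<close> to \<open>a w\<^sub>1 + m\<close>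
  (lemma \<open>mem_dilate_cycle_polytope_iff\<close>). Its first component records, at each vertex, the sum of
  the weights of the two incident edges. If these sums are integers, the weights alternate modulo
  \<open>\<int>\<close> between \<open>w\<^sub>1\<close> and \<open>-w\<^sub>1\<close> (lemma \<open>alternating_integrality\<close>), and everything depends on
  whether \<open>w\<^sub>1\<close> can be replaced by an integer. A lattice point is a sum of \<open>m\<close> points
  \<open>(V(e), h)\<close> as soon as its weights can be chosen to be integers.

  The first component does not change when a constant is added to the odd weights and subtracted
  from the even ones. Hence \<open>w\<^sub>1\<close> may be rounded down or up, which keeps all weights nonnegative.
  The two intervals of admissible heights over \<open>t = \<lfloor>w\<^sub>1\<rfloor>\<close> and \<open>t + 1\<close> are
  \<open>[at, at + m]\<close> and \<open>[at + a, at + a + m]\<close>; together they contain all the integers between their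
  extremes once \<open>m \<ge> a - 1\<close>. So large dilatations decompose, and \<open>\<P>\<close> is very ample.

  If \<open>a = k + 2\<close>, the point \<open>((1, \<dots>, 1), k + 1)\<close> lies in \<open>k\<P>\<close> (all weights one half), but its
  height falls into the gap between \<open>[0, k]\<close> and \<open>[k + 2, 2k + 2]\<close>. When \<open>s\<close> divides \<open>k\<close>, this is a
  point of \<open>(k/s)(s\<P>)\<close>. When moreover \<open>s < k\<close>, a lattice point of \<open>s\<P>\<close> has too little weight to
  be positive at all vertices; at a vertex where it vanishes both incident weights vanish, so that
  \<open>w\<^sub>1\<close> is an integer for every summand. The summands can then only reach the two intervals, never
  the gap. Every \<open>s \<le> n\<close> divides \<open>n!\<close>, which makes one polytope serve for all these \<open>s\<close>.
\<close>

section \<open>Dilatations as weightings of the edges\<close>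

definition edge_combination :: "nat \<Rightarrow> (nat \<Rightarrow> real) \<Rightarrow> nat \<Rightarrow> real" where
  "edge_combination k w = (\<lambda>v. \<Sum>i\<in>{1..2*k}. w i * edge_vector (cycle_edge k i) v)"

text \<open>Total weights and heights are real, so that the same notion covers the polytope itself
  and its scaling by arbitrary factors. The height bound pools the unit segments above all the
  edges: only the total height is constrained, not its distribution over the edges.\<close>

definition edge_weighting :: "nat \<Rightarrow> nat \<Rightarrow> real \<Rightarrow> (nat \<Rightarrow> real) \<Rightarrow> (nat \<Rightarrow> real) \<times> real \<Rightarrow> bool" where
  "edge_weighting k a m w p \<longleftrightarrow>
     (\<forall>i\<in>{1..2*k}. 0 \<le> w i) \<and> (\<Sum>i\<in>{1..2*k}. w i) = m \<and> fst p = edge_combination k w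
     \<and> real a * w 1 \<le> snd p \<and> snd p \<le> real a * w 1 + m"

definition base_height :: "nat \<Rightarrow> nat \<Rightarrow> real" where
  "base_height a i = (if i = 1 then real a else 0)"

lemma sum_fun_apply: "(\<Sum>i\<in>A. f i) v = (\<Sum>i\<in>A. f i v)"
  for f :: "'i \<Rightarrow> 'b \<Rightarrow> 'c::comm_monoid_add"
  by (induction A rule: infinite_finite_induct) auto

lemma sum_base_height:
  assumes "k \<ge> 1"
  shows "(\<Sum>i\<in>{1..2*k}. w i * base_height a i) = real a * w 1"
proof -
  have "(\<Sum>i\<in>{1..2*k}. w i * base_height a i) = (\<Sum>i\<in>{1..2*k}. if i = 1 then real a * w 1 else 0)"
    by (intro sum.cong) (auto simp: base_height_def)
  also have "\<dots> = real a * w 1"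
    using assms by (subst sum.delta) auto
  finally show ?thesis .
qed

lemma edge_combination_apply:
  assumes "k \<ge> 1"
  shows "edge_combination k w v =
    (if v \<in> {1..2*k} then w v + w (if v = 1 then 2*k else v - 1) else 0)"
proof (cases "v \<in> {1..2*k}")
  case True
  define u where "u = (if v = 1 then 2*k else v - 1)"
  have u: "u \<in> {1..2*k}" "u \<noteq> v"
    using True assms by (auto simp: u_def)
  have "edge_combination k w v = (\<Sum>i\<in>{1..2*k}. (if i = v then w i else 0) + (if i = u then w i else 0))"
    unfolding edge_combination_def edge_vector_def cycle_edge_def
    using True u by (intro sum.cong refl) (auto simp: u_def split: if_splits)
  also have "\<dots> = w v + w u"
    using True u by (simp add: sum.distrib)
  finally show ?thesis
    using True by (simp add: u_def)
next
  case False
  then show ?thesis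
    using assms unfolding edge_combination_def edge_vector_def cycle_edge_def
    by (auto intro!: sum.neutral)
qed

lemma generator_mem_cycle_polytope:
  assumes "i \<in> {1..2*k}"
  shows "(edge_vector (cycle_edge k i), base_height a i) \<in> cycle_polytope k a"
    and "(edge_vector (cycle_edge k i), base_height a i + 1) \<in> cycle_polytope k a"
proof -
  show "(edge_vector (cycle_edge k i), base_height a i) \<in> cycle_polytope k a"
    unfolding cycle_polytope_def base_height_def
    using assms by (intro hull_inc) (cases "i = 1"; force)
  show "(edge_vector (cycle_edge k i), base_height a i + 1) \<in> cycle_polytope k a"
    unfolding cycle_polytope_def base_height_def
    using assms by (intro hull_inc) (cases "i = 1"; force)
qed

lemma edge_weighting_generator:
  assumes "i \<in> {1..2*k}" "base_height a i \<le> z" "z \<le> base_height a i + 1"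
  shows "edge_weighting k a 1 (\<lambda>j. if j = i then 1 else 0) (edge_vector (cycle_edge k i), z)"
proof -
  have "edge_combination k (\<lambda>j. if j = i then 1 else 0) = edge_vector (cycle_edge k i)"
  proof
    fix v
    have "edge_combination k (\<lambda>j. if j = i then 1 else 0) v
        = (\<Sum>j\<in>{1..2*k}. if j = i then edge_vector (cycle_edge k i) v else 0)"
      unfolding edge_combination_def by (intro sum.cong) auto
    then show "edge_combination k (\<lambda>j. if j = i then 1 else 0) v = edge_vector (cycle_edge k i) v"
      using assms(1) by simp
  qed
  then show ?thesis
    using assms unfolding edge_weighting_def base_height_def by (auto split: if_splits)
qed

lemma convex_edge_weighting: "convex {p. \<exists>w. edge_weighting k a 1 w p}"
proof (rule convexI, clarsimp)
  fix x z y t w w' and u v :: real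
  assume w: "edge_weighting k a 1 w (x, z)" and w': "edge_weighting k a 1 w' (y, t)"
    and uv: "0 \<le> u" "0 \<le> v" "u + v = 1"
  have "edge_weighting k a 1 (\<lambda>i. u * w i + v * w' i) (u *\<^sub>R x + v *\<^sub>R y, u * z + v * t)"
    unfolding edge_weighting_def
  proof (intro conjI)
    show "\<forall>i\<in>{1..2*k}. 0 \<le> u * w i + v * w' i"
      using w w' uv by (simp add: edge_weighting_def)
    show "(\<Sum>i\<in>{1..2*k}. u * w i + v * w' i) = 1"
      using w w' uv by (simp add: edge_weighting_def sum.distrib flip: sum_distrib_left)
    show "fst (u *\<^sub>R x + v *\<^sub>R y, u * z + v * t) = edge_combination k (\<lambda>i. u * w i + v * w' i)"
      using w w'
      by (auto simp: edge_weighting_def edge_combination_def fun_eq_iff algebra_simps sum.distrib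
          sum_distrib_left)
    have "u * (a * w 1) \<le> u * z" "v * (a * w' 1) \<le> v * t"
      using w w' uv by (auto simp: edge_weighting_def intro!: mult_left_mono)
    then show "real a * (u * w 1 + v * w' 1) \<le> snd (u *\<^sub>R x + v *\<^sub>R y, u * z + v * t)"
      by (simp add: algebra_simps)
    have "u * z \<le> u * (a * w 1 + 1)" "v * t \<le> v * (a * w' 1 + 1)"
      using w w' uv by (auto simp: edge_weighting_def intro!: mult_left_mono)
    then show "snd (u *\<^sub>R x + v *\<^sub>R y, u * z + v * t) \<le> real a * (u * w 1 + v * w' 1) + 1"
      using uv by (simp add: algebra_simps)
  qed
  then show "\<exists>w. edge_weighting k a 1 w (u *\<^sub>R x + v *\<^sub>R y, u * z + v * t)"
    by blast
qed

lemma mem_cycle_polytope_iff: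
  assumes "k \<ge> 1"
  shows "p \<in> cycle_polytope k a \<longleftrightarrow> (\<exists>w. edge_weighting k a 1 w p)"
proof
  assume "p \<in> cycle_polytope k a"
  moreover have "cycle_polytope k a \<subseteq> {p. \<exists>w. edge_weighting k a 1 w p}"
    unfolding cycle_polytope_def
  proof (rule hull_minimal)
    show "convex {p. \<exists>w. edge_weighting k a 1 w p}"
      by (rule convex_edge_weighting)
    have "\<exists>w. edge_weighting k a 1 w (edge_vector (cycle_edge k i), z)"
      if "i \<in> {1..2*k}" "z = base_height a i \<or> z = base_height a i + 1" for i z
      using edge_weighting_generator[of i k a z] that by auto
    from this[of 1] this show "(\<Union>i\<in>{2..2*k}. {(edge_vector (cycle_edge k i), 0), (edge_vector (cycle_edge k i), 1)})
      \<union> {(edge_vector (cycle_edge k 1), real a), (edge_vector (cycle_edge k 1), real a + 1)}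
      \<subseteq> {p. \<exists>w. edge_weighting k a 1 w p}"
      using assms by (auto simp: base_height_def)
  qed
  ultimately show "\<exists>w. edge_weighting k a 1 w p" by blast
next
  assume "\<exists>w. edge_weighting k a 1 w p"
  then obtain w where w: "edge_weighting k a 1 w p" ..
  define u where "u = snd p - real a * w 1"
  have u: "0 \<le> u" "u \<le> 1"
    using w by (auto simp: u_def edge_weighting_def)
  have conv: "convex (cycle_polytope k a)"
    unfolding cycle_polytope_def by (rule convex_convex_hull)
  \<comment> \<open>The same relative height \<open>u\<close> is used on the vertical segment over every edge vector.\<close>
  define q where "q i = (edge_vector (cycle_edge k i), base_height a i + u)" for i
  have q: "q i \<in> cycle_polytope k a" if i: "i \<in> {1..2*k}" for i
  proof -
    have "(1 - u) *\<^sub>R (edge_vector (cycle_edge k i), base_height a i)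
        + u *\<^sub>R (edge_vector (cycle_edge k i), base_height a i + 1) \<in> cycle_polytope k a"
      using u by (intro convexD[OF conv] generator_mem_cycle_polytope i) auto
    also have "(1 - u) *\<^sub>R (edge_vector (cycle_edge k i), base_height a i)
        + u *\<^sub>R (edge_vector (cycle_edge k i), base_height a i + 1) = q i"
      by (auto simp: q_def fun_eq_iff algebra_simps)
    finally show ?thesis .
  qed
  have "(\<Sum>i\<in>{1..2*k}. w i *\<^sub>R q i) \<in> cycle_polytope k a"
    using w q conv by (intro convex_sum) (auto simp: edge_weighting_def)
  also have "(\<Sum>i\<in>{1..2*k}. w i *\<^sub>R q i) = p"
  proof (rule prod_eqI)
    show "fst (\<Sum>i\<in>{1..2*k}. w i *\<^sub>R q i) = fst p"
      using w by (auto simp: q_def fst_sum edge_weighting_def edge_combination_def sum_fun_apply)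
    have "snd (\<Sum>i\<in>{1..2*k}. w i *\<^sub>R q i)
        = (\<Sum>i\<in>{1..2*k}. w i * base_height a i) + (\<Sum>i\<in>{1..2*k}. w i) * u"
      by (simp add: q_def snd_sum algebra_simps sum.distrib sum_distrib_left)
    also have "\<dots> = snd p"
      using w by (simp only: sum_base_height[OF assms]) (simp add: edge_weighting_def u_def)
    finally show "snd (\<Sum>i\<in>{1..2*k}. w i *\<^sub>R q i) = snd p" .
  qed
  finally show "p \<in> cycle_polytope k a" .
qed

lemma edge_weighting_scale:
  assumes "edge_weighting k a m w p" "0 \<le> c"
  shows "edge_weighting k a (c * m) (\<lambda>i. c * w i) (c *\<^sub>R p)"
proof -
  have "c * (a * w 1) \<le> c * snd p" "c * snd p \<le> c * (a * w 1 + m)"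
    using assms by (auto simp: edge_weighting_def intro!: mult_left_mono)
  then show ?thesis
    using assms
    by (auto simp: edge_weighting_def edge_combination_def fun_eq_iff algebra_simps
        sum_distrib_left)
qed

lemma mem_dilate_cycle_polytope_iff:
  assumes "k \<ge> 1" "m \<ge> 1"
  shows "p \<in> dilate m (cycle_polytope k a) \<longleftrightarrow> (\<exists>w. edge_weighting k a (real m) w p)"
proof
  assume "p \<in> dilate m (cycle_polytope k a)"
  then obtain q where q: "p = real m *\<^sub>R q" "q \<in> cycle_polytope k a"
    unfolding dilate_def by blast
  then obtain w where "edge_weighting k a 1 w q"
    using mem_cycle_polytope_iff[OF assms(1)] by blast
  then show "\<exists>w. edge_weighting k a (real m) w p"
    using edge_weighting_scale[of k a 1 w q "real m"] q(1) by auto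
next
  assume "\<exists>w. edge_weighting k a (real m) w p"
  then obtain w where "edge_weighting k a (real m) w p" ..
  then have "edge_weighting k a 1 (\<lambda>i. (1 / real m) * w i) ((1 / real m) *\<^sub>R p)"
    using edge_weighting_scale[of k a "real m" w p "1 / real m"] assms by simp
  then have "(1 / real m) *\<^sub>R p \<in> cycle_polytope k a"
    using mem_cycle_polytope_iff[OF assms(1)] by blast
  moreover have "p = real m *\<^sub>R (1 / real m) *\<^sub>R p"
    using assms by simp
  ultimately show "p \<in> dilate m (cycle_polytope k a)"
    unfolding dilate_def by blast
qed

lemma dilate_dilate: "dilate m (dilate s P) = dilate (m * s) P"
  by (simp add: dilate_def image_image)


section \<open>Integrality of weights\<close>

lemma alternating_integrality:
  assumes k: "k \<ge> 1" and int: "\<And>v. edge_combination k w v \<in> \<int>"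
    and "1 \<le> i" "i \<le> 2*k"
  shows "(if odd i then w i - w 1 else w i + w 1) \<in> \<int>"
  using assms(3,4)
proof (induction i rule: dec_induct)
  case (step i)
  have "w (Suc i) + w i \<in> \<int>"
    using int[of "Suc i"] step.hyps step.prems by (simp add: edge_combination_apply[OF k])
  moreover have "(if odd i then w i - w 1 else w i + w 1) \<in> \<int>"
    using step by auto
  ultimately have "w (Suc i) + w i - (if odd i then w i - w 1 else w i + w 1) \<in> \<int>"
    by (rule Ints_diff)
  then show ?case
    by (cases "odd i") (auto simp: algebra_simps)
qed simp

definition alternating_shift :: "real \<Rightarrow> (nat \<Rightarrow> real) \<Rightarrow> nat \<Rightarrow> real" where
  "alternating_shift t w i = (if odd i then w i + t else w i - t)"

lemma edge_combination_alternating_shift: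
  assumes "k \<ge> 1"
  shows "edge_combination k (alternating_shift t w) = edge_combination k w"
proof
  fix v
  show "edge_combination k (alternating_shift t w) v = edge_combination k w v"
  proof (cases "v = 1")
    case True
    then show ?thesis
      using assms by (simp add: edge_combination_apply alternating_shift_def)
  next
    case False
    then show ?thesis
      using assms by (cases v) (auto simp: edge_combination_apply alternating_shift_def)
  qed
qed

text \<open>The even vertices form a vertex cover in which every edge is counted exactly once.\<close>

lemma sum_edge_combination_even:
  assumes "k \<ge> 1"
  shows "(\<Sum>j\<in>{1..k}. edge_combination k w (2*j)) = (\<Sum>i\<in>{1..2*k}. w i)"
proof -
  have "(\<Sum>j\<in>{1..k}. edge_combination k w (2*j)) = (\<Sum>j\<in>{1..k}. w (2*j) + w (2*j - 1))"
    using assms by (intro sum.cong) (auto simp: edge_combination_apply)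
  also have "\<dots> = (\<Sum>i\<in>{1..2*k}. w i)"
    by (induction k) (auto simp: algebra_simps)
  finally show ?thesis .
qed


section \<open>Very ampleness\<close>

text \<open>If the height exceeds \<open>a \<lfloor>w 1\<rfloor> + m\<close>, then, being an integer, it is at least
  \<open>a \<lfloor>w 1\<rfloor> + m + 1 \<ge> a (\<lfloor>w 1\<rfloor> + 1)\<close>, so the first weight can be rounded up instead of down.
  Integrality of the height is essential here: over real heights the two intervals may leave a gap
  of length one.\<close>

lemma edge_weighting_integral_rounding:
  assumes k: "k \<ge> 1" and am: "a \<le> m + 1" and w: "edge_weighting k a (real m) w p"
    and p: "p \<in> cycle_lattice k"
  obtains w' where "edge_weighting k a (real m) w' p" "\<And>i. i \<in> {1..2*k} \<Longrightarrow> w' i \<in> \<int>"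
proof -
  have int: "edge_combination k w v \<in> \<int>" for v
    using w p by (cases p) (auto simp: edge_weighting_def cycle_lattice_def)
  have nonneg: "0 \<le> w i" if "i \<in> {1..2*k}" for i
    using w that by (auto simp: edge_weighting_def)
  have shift_sum: "(\<Sum>i\<in>{1..2*k}. alternating_shift t w i) = real m" for t
    using w sum_edge_combination_even[OF k, of w]
      sum_edge_combination_even[OF k, of "alternating_shift t w"]
    by (simp add: edge_weighting_def edge_combination_alternating_shift[OF k])
  have shift: "edge_weighting k a (real m) (alternating_shift (real_of_int c - w 1) w) p"
    and shift_int: "\<And>i. i \<in> {1..2*k} \<Longrightarrow> alternating_shift (real_of_int c - w 1) w i \<in> \<int>"
    if c: "\<bar>real_of_int c - w 1\<bar> < 1" and z: "a * c \<le> snd p" "snd p \<le> a * c + m" for c :: int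
  proof -
    show *: "alternating_shift (real_of_int c - w 1) w i \<in> \<int>" if i: "i \<in> {1..2*k}" for i
    proof (cases "odd i")
      case True
      then have "(w i - w 1) + real_of_int c \<in> \<int>"
        using alternating_integrality[OF k int, of i] i by (intro Ints_add) auto
      then show ?thesis
        using True by (simp add: alternating_shift_def algebra_simps)
    next
      case False
      then have "(w i + w 1) - real_of_int c \<in> \<int>"
        using alternating_integrality[OF k int, of i] i by (intro Ints_diff) auto
      then show ?thesis
        using False by (simp add: alternating_shift_def algebra_simps)
    qed
    \<comment> \<open>A weight that moves by less than one to an integer stays greater than \<open>-1\<close>, hence nonnegative.\<close>
    have "0 \<le> alternating_shift (real_of_int c - w 1) w i" if i: "i \<in> {1..2*k}" for i
    proof -
      obtain d where d: "alternating_shift (real_of_int c - w 1) w i = real_of_int d"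
        using *[OF i] by (auto elim: Ints_cases)
      have "alternating_shift (real_of_int c - w 1) w i > -1"
        using c nonneg[OF i] by (auto simp: alternating_shift_def)
      then show ?thesis
        using d by simp
    qed
    then show "edge_weighting k a (real m) (alternating_shift (real_of_int c - w 1) w) p"
      using w z shift_sum unfolding edge_weighting_def edge_combination_alternating_shift[OF k]
      by (simp add: alternating_shift_def)
  qed
  obtain z where z: "snd p = real_of_int z"
    using p by (cases p) (auto simp: cycle_lattice_def elim: Ints_cases)
  define c where "c = \<lfloor>w 1\<rfloor>"
  have c: "real_of_int c \<le> w 1" "w 1 < real_of_int c + 1"
    by (auto simp: c_def)
  have bounds: "a * w 1 \<le> snd p" "snd p \<le> a * w 1 + m"
    using w by (auto simp: edge_weighting_def)
  have mono: "a * real_of_int c \<le> a * w 1" "a * w 1 \<le> a * (real_of_int c + 1)"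
    using c by (auto intro!: mult_left_mono)
  show thesis
  proof (cases "z \<le> a * c + m \<or> w 1 = real_of_int c")
    case True
    have "snd p \<le> a * real_of_int c + m"
      using True
    proof
      assume "z \<le> int a * c + int m"
      then have "real_of_int z \<le> real_of_int (int a * c + int m)"
        by (simp only: of_int_le_iff)
      then show ?thesis
        using z by simp
    qed (use bounds in auto)
    then show thesis
      using that[OF shift[of c] shift_int[of c]] c bounds mono by auto
  next
    case False
    then have "a * c + a \<le> z"
      using am by linarith
    then have "real_of_int (a * c + a) \<le> real_of_int z"
      by (simp only: of_int_le_iff)
    then have "a * real_of_int (c + 1) \<le> snd p"
      using z by (simp add: algebra_simps)
    then show thesis
      using that[OF shift[of "c + 1"] shift_int[of "c + 1"]] c bounds mono False by auto
  qed
qed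

lemma multiplicities_as_sequence:
  fixes w :: "'i \<Rightarrow> nat"
  assumes "finite A" "(\<Sum>i\<in>A. w i) = m"
  shows "\<exists>e. (\<forall>j<m. e j \<in> A) \<and> (\<forall>g :: 'i \<Rightarrow> real. (\<Sum>j<m. g (e j)) = (\<Sum>i\<in>A. real (w i) * g i))"
  using assms(2)
proof (induction m arbitrary: w)
  case 0
  then show ?case
    using assms(1) by auto
next
  case (Suc m)
  then obtain b where b: "b \<in> A" "w b > 0"
    by (metis Suc_neq_Zero gr0I sum.neutral)
  define w' where "w' = w(b := w b - 1)"
  have split: "real (w i) * g i = real (w' i) * g i + (if i = b then g i else 0)"
    for i and g :: "'i \<Rightarrow> real"
    using b by (auto simp: w'_def algebra_simps of_nat_diff)
  have sumw: "(\<Sum>i\<in>A. real (w i) * g i) = (\<Sum>i\<in>A. real (w' i) * g i) + g b" for g :: "'i \<Rightarrow> real"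
    using b assms(1) by (simp add: split sum.distrib)
  have "(\<Sum>i\<in>A. real (w' i)) = real m"
    using sumw[of "\<lambda>_. 1"] Suc.prems by (simp flip: of_nat_sum)
  then have "(\<Sum>i\<in>A. w' i) = m"
    by (simp flip: of_nat_sum)
  then obtain e where e: "\<forall>j<m. e j \<in> A"
      "\<forall>g :: 'i \<Rightarrow> real. (\<Sum>j<m. g (e j)) = (\<Sum>i\<in>A. real (w' i) * g i)"
    using Suc.IH by blast
  have "\<forall>j<Suc m. (e(m := b)) j \<in> A"
    using e b by (auto simp: less_Suc_eq)
  moreover have "(\<Sum>j<Suc m. g ((e(m := b)) j)) = (\<Sum>i\<in>A. real (w i) * g i)" for g :: "'i \<Rightarrow> real"
    using e(2) sumw by simp
  ultimately show ?case by blast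
qed

lemma edge_vector_mem_cycle_lattice:
  assumes "i \<in> {1..2*k}" "z \<in> \<int>"
  shows "(edge_vector (cycle_edge k i), z) \<in> cycle_lattice k"
  using assms by (auto simp: cycle_lattice_def edge_vector_def cycle_edge_def)

lemma base_height_Ints: "base_height a i \<in> \<int>"
  by (simp add: base_height_def)

lemma integral_edge_weighting_decomposes:
  assumes k: "k \<ge> 1" and w: "edge_weighting k a (real m) w p"
    and wint: "\<And>i. i \<in> {1..2*k} \<Longrightarrow> w i \<in> \<int>" and p: "p \<in> cycle_lattice k"
  shows "\<exists>q. (\<forall>j<m. q j \<in> cycle_polytope k a \<inter> cycle_lattice k) \<and> p = (\<Sum>j<m. q j)"
proof -
  define n where "n i = nat \<lfloor>w i\<rfloor>" for i
  have n: "real (n i) = w i" if "i \<in> {1..2*k}" for i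
    using wint[OF that] w that by (auto simp: n_def edge_weighting_def elim!: Ints_cases)
  have "(\<Sum>i\<in>{1..2*k}. real (n i)) = real m"
    using w n by (simp add: edge_weighting_def)
  then have "(\<Sum>i\<in>{1..2*k}. n i) = m"
    by (simp flip: of_nat_sum)
  then obtain e where e: "\<forall>j<m. e j \<in> {1..2*k}"
      "\<And>g :: nat \<Rightarrow> real. (\<Sum>j<m. g (e j)) = (\<Sum>i\<in>{1..2*k}. real (n i) * g i)"
    using multiplicities_as_sequence[of "{1..2*k}" n m] by blast
  have e': "(\<Sum>j<m. g (e j)) = (\<Sum>i\<in>{1..2*k}. w i * g i)" for g :: "nat \<Rightarrow> real"
    using n by (simp add: e(2))
  have "snd p - a * w 1 \<in> \<int>"
    using p wint[of 1] k by (cases p) (auto simp: cycle_lattice_def)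
  then obtain c where "snd p - a * w 1 = real_of_int c"
    by (elim Ints_cases)
  then obtain u where u: "snd p - a * w 1 = real u" "u \<le> m"
    using w by (intro that[of "nat c"]) (auto simp: edge_weighting_def)
  \<comment> \<open>The remaining height \<open>u\<close> is distributed by raising the first \<open>u\<close> summands by one.\<close>
  define q where "q j = (edge_vector (cycle_edge k (e j)), base_height a (e j) + (if j < u then 1 else 0))" for j
  have "q j \<in> cycle_polytope k a \<inter> cycle_lattice k" if "j < m" for j
    using e(1) that generator_mem_cycle_polytope[of "e j" k a]
    by (auto simp: q_def base_height_Ints intro!: edge_vector_mem_cycle_lattice)
  moreover have "p = (\<Sum>j<m. q j)"
  proof (rule prod_eqI)
    show "fst p = fst (\<Sum>j<m. q j)"
    proof
      fix v
      show "fst p v = fst (\<Sum>j<m. q j) v"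
        using w e'[of "\<lambda>i. edge_vector (cycle_edge k i) v"]
        by (simp add: q_def fst_sum sum_fun_apply edge_weighting_def edge_combination_def)
    qed
    have "(\<Sum>j<m. if j < u then 1 else 0) = (\<Sum>j<u. 1::real)"
      using u(2) by (intro sum.mono_neutral_cong_right) auto
    then have "snd (\<Sum>j<m. q j) = a * w 1 + real u"
      using e'[of "base_height a"] sum_base_height[OF k, of w a]
      by (simp add: q_def snd_sum sum.distrib)
    then show "snd p = snd (\<Sum>j<m. q j)"
      using u(1) by simp
  qed
  ultimately show ?thesis by blast
qed

lemma very_ample_cycle_polytope:
  assumes k: "k \<ge> 1"
  shows "very_ample_polytope (cycle_lattice k) (cycle_polytope k a)"
  unfolding very_ample_polytope_def
proof (rule eventually_sequentiallyI[of "a + 1"])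
  fix m assume m: "a + 1 \<le> m"
  show "lattice_points_decompose (cycle_lattice k) (cycle_polytope k a) m"
    unfolding lattice_points_decompose_def
  proof
    fix p assume p: "p \<in> dilate m (cycle_polytope k a) \<inter> cycle_lattice k"
    then obtain w where "edge_weighting k a (real m) w p"
      using mem_dilate_cycle_polytope_iff[OF k, of m] m by auto
    then obtain w' where "edge_weighting k a (real m) w' p" "\<And>i. i \<in> {1..2*k} \<Longrightarrow> w' i \<in> \<int>"
      using edge_weighting_integral_rounding[OF k, of a m w p] m p by auto
    then show "\<exists>q. (\<forall>j<m. q j \<in> cycle_polytope k a \<inter> cycle_lattice k) \<and> p = (\<Sum>j<m. q j)"
      using integral_edge_weighting_decomposes[OF k] p by blast
  qed
qed


section \<open>Non-normal dilatations\<close>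

text \<open>With total weight below \<open>k\<close>, some even vertex has value less than one, hence zero. Both
  weights there vanish, and integrality spreads from these weights around the cycle.\<close>

lemma first_weight_integral:
  assumes k: "k \<ge> 1" and "s < k" and w: "edge_weighting k a (real s) w p"
    and p: "p \<in> cycle_lattice k"
  shows "w 1 \<in> \<int>"
proof -
  have int: "edge_combination k w v \<in> \<int>" for v
    using w p by (cases p) (auto simp: edge_weighting_def cycle_lattice_def)
  have nonneg: "0 \<le> w i" if "i \<in> {1..2*k}" for i
    using w that by (auto simp: edge_weighting_def)
  have "\<exists>j\<in>{1..k}. edge_combination k w (2*j) < 1"
  proof (rule ccontr)
    assume "\<not> ?thesis"
    then have "(\<Sum>j\<in>{1..k}. 1) \<le> (\<Sum>j\<in>{1..k}. edge_combination k w (2*j))"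
      by (intro sum_mono) (simp add: not_less)
    then show False
      using w \<open>s < k\<close> unfolding sum_edge_combination_even[OF k] edge_weighting_def by simp
  qed
  then obtain j where j: "j \<in> {1..k}" "edge_combination k w (2*j) < 1"
    by blast
  have comb: "edge_combination k w (2*j) = w (2*j) + w (2*j - 1)"
    using j(1) by (auto simp: edge_combination_apply[OF k])
  obtain d where d: "edge_combination k w (2*j) = real_of_int d"
    using int[of "2*j"] by (elim Ints_cases)
  have nn: "0 \<le> w (2*j)" "0 \<le> w (2*j - 1)"
    using j(1) by (auto intro!: nonneg)
  have "d = 0"
    using d comb nn j(2) by linarith
  then have "w (2*j) = 0"
    using d comb nn by linarith
  then show ?thesis
    using alternating_integrality[OF k int, of "2*j"] j(1) by auto
qed

definition gap_point :: "nat \<Rightarrow> (nat \<Rightarrow> real) \<times> real" where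
  "gap_point k = (\<lambda>v. if v \<in> {1..2*k} then 1 else 0, real k + 1)"

lemma gap_point_mem_lattice: "gap_point k \<in> cycle_lattice k"
  by (auto simp: gap_point_def cycle_lattice_def)

lemma gap_point_mem_dilate:
  assumes k: "k \<ge> 1"
  shows "gap_point k \<in> dilate k (cycle_polytope k (k + 2))"
proof -
  have "edge_weighting k (k + 2) (real k) (\<lambda>_. 1/2) (gap_point k)"
    using k by (auto simp: edge_weighting_def gap_point_def fun_eq_iff edge_combination_apply)
  then show ?thesis
    using mem_dilate_cycle_polytope_iff[OF k k] by blast
qed

text \<open>The summands of a decomposition have integral first weights. These add up to an integer \<open>t\<close>
  that is at most the value \<open>1\<close> at vertex \<open>1\<close>, and neither \<open>t = 0\<close> nor \<open>t = 1\<close> allows the height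
  \<open>k + 1\<close>.\<close>

lemma dilate_cycle_polytope_not_normal:
  assumes "s \<ge> 1" "s < k" "s dvd k"
  shows "\<not> normal_polytope (cycle_lattice k) (dilate s (cycle_polytope k (k + 2)))"
proof
  assume normal: "normal_polytope (cycle_lattice k) (dilate s (cycle_polytope k (k + 2)))"
  have k: "k \<ge> 1"
    using assms by simp
  obtain m where m: "k = m * s"
    using assms(3) by (metis dvdE mult.commute)
  have "m \<ge> 1"
    using m k by (cases m) auto
  then have "lattice_points_decompose (cycle_lattice k) (dilate s (cycle_polytope k (k + 2))) m"
    using normal by (simp add: normal_polytope_def)
  moreover have "gap_point k \<in> dilate m (dilate s (cycle_polytope k (k + 2))) \<inter> cycle_lattice k"
    using gap_point_mem_dilate[OF k] gap_point_mem_lattice m by (simp add: dilate_dilate)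
  ultimately obtain q where
    q: "\<forall>j<m. q j \<in> dilate s (cycle_polytope k (k + 2)) \<inter> cycle_lattice k"
    and sum_q: "gap_point k = (\<Sum>j<m. q j)"
    unfolding lattice_points_decompose_def by blast
  then have "\<forall>j<m. \<exists>w. edge_weighting k (k + 2) (real s) w (q j)"
    using mem_dilate_cycle_polytope_iff[OF k assms(1)] by blast
  then obtain W where W: "\<And>j. j < m \<Longrightarrow> edge_weighting k (k + 2) (real s) (W j) (q j)"
    by metis
  define t where "t = (\<Sum>j<m. W j 1)"
  have "t \<in> \<int>"
    unfolding t_def using q W first_weight_integral[OF k assms(2)] by (intro Ints_sum) blast
  have nonneg: "0 \<le> W j i" if "j < m" "i \<in> {1..2*k}" for i j
    using W[OF that(1)] that(2) by (auto simp: edge_weighting_def)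
  have "0 \<le> t"
    unfolding t_def using nonneg k by (intro sum_nonneg) auto
  have "t \<le> (\<Sum>j<m. fst (q j) 1)"
    unfolding t_def
  proof (rule sum_mono)
    fix j assume "j \<in> {..<m}"
    then have j: "j < m" by simp
    show "W j 1 \<le> fst (q j) 1"
      using W[OF j] nonneg[OF j, of "2*k"] k by (simp add: edge_weighting_def edge_combination_apply)
  qed
  also have "\<dots> = fst (gap_point k) 1"
    by (simp add: sum_q fst_sum sum_fun_apply)
  also have "\<dots> = 1"
    using k by (simp add: gap_point_def)
  finally have "t \<le> 1" .
  then consider "t = 0" | "t = 1"
    using \<open>t \<in> \<int>\<close> \<open>0 \<le> t\<close> by (elim Ints_cases) force
  moreover have height: "real k + 1 = (\<Sum>j<m. snd (q j))"
    using sum_q by (simp add: snd_sum gap_point_def prod_eq_iff)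
  have "(\<Sum>j<m. real (k + 2) * W j 1) \<le> (\<Sum>j<m. snd (q j))"
    using W by (intro sum_mono) (auto simp: edge_weighting_def)
  then have "real (k + 2) * t \<le> real k + 1"
    by (simp add: t_def height sum_distrib_left)
  moreover have "(\<Sum>j<m. snd (q j)) \<le> (\<Sum>j<m. real (k + 2) * W j 1 + real s)"
    using W by (intro sum_mono) (auto simp: edge_weighting_def)
  moreover have "\<dots> = real (k + 2) * t + real k"
    unfolding t_def sum.distrib sum_distrib_left using m by simp
  ultimately show False
    unfolding height[symmetric] by cases auto
qed

lemma lattice_polytope_cycle_polytope:
  assumes "k \<ge> 1"
  shows "lattice_polytope (cycle_lattice k) (cycle_polytope k a)"
  unfolding lattice_polytope_def cycle_polytope_def
proof (intro exI conjI)
  show "(\<Union>i\<in>{2..2*k}. {(edge_vector (cycle_edge k i), 0), (edge_vector (cycle_edge k i), 1)})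
      \<union> {(edge_vector (cycle_edge k 1), real a), (edge_vector (cycle_edge k 1), real a + 1)}
      \<subseteq> cycle_lattice k"
    using assms by (auto intro!: edge_vector_mem_cycle_lattice)
qed (rule refl | simp)+

theorem mainTheorem5:
  shows "\<not> (\<forall>k\<ge>1. \<forall>P. lattice_polytope (cycle_lattice k) P \<and> very_ample_polytope (cycle_lattice k) P
             \<longrightarrow> normal_polytope (cycle_lattice k) (dilate 2 P))
    \<and> (\<forall>k a. k \<ge> 1 \<longrightarrow> very_ample_polytope (cycle_lattice k) (cycle_polytope k a))
    \<and> (\<forall>n s. n \<ge> 1 \<and> 1 \<le> s \<and> s \<le> n \<and> s < fact n
             \<longrightarrow> \<not> normal_polytope (cycle_lattice (fact n)) (dilate s (cycle_polytope (fact n) (fact n + 2))))"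
proof (intro conjI)
  show "\<not> (\<forall>k\<ge>1. \<forall>P. lattice_polytope (cycle_lattice k) P \<and> very_ample_polytope (cycle_lattice k) P
             \<longrightarrow> normal_polytope (cycle_lattice k) (dilate 2 P))"
  proof
    assume "\<forall>k\<ge>1. \<forall>P. lattice_polytope (cycle_lattice k) P \<and> very_ample_polytope (cycle_lattice k) P
             \<longrightarrow> normal_polytope (cycle_lattice k) (dilate 2 P)"
    \<comment> \<open>The number \<open>4\<close> is the least \<open>k\<close> with \<open>2\<close> as a proper divisor.\<close>
    then have "normal_polytope (cycle_lattice 4) (dilate 2 (cycle_polytope 4 (4 + 2)))"
      by (simp add: lattice_polytope_cycle_polytope very_ample_cycle_polytope)
    then show False
      using dilate_cycle_polytope_not_normal[of 2 4] by simp
  qed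
  show "\<forall>k a. k \<ge> 1 \<longrightarrow> very_ample_polytope (cycle_lattice k) (cycle_polytope k a)"
    by (simp add: very_ample_cycle_polytope)
  show "\<forall>n s. n \<ge> 1 \<and> 1 \<le> s \<and> s \<le> n \<and> s < fact n
             \<longrightarrow> \<not> normal_polytope (cycle_lattice (fact n)) (dilate s (cycle_polytope (fact n) (fact n + 2)))"
  proof (intro allI impI)
    fix n s :: nat
    assume "n \<ge> 1 \<and> 1 \<le> s \<and> s \<le> n \<and> s < fact n"
    then show "\<not> normal_polytope (cycle_lattice (fact n)) (dilate s (cycle_polytope (fact n) (fact n + 2)))"
      by (intro dilate_cycle_polytope_not_normal) (auto intro: dvd_fact)
  qed
qed

end
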